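(* Let $a,b,c,d,w,x,y,z$ be eight distinct spin orbitals, and let $\eta_1,\eta_2$ be two further distinct (ancilla) spin orbitals. Let $\theta\in\mathbb{R}$. Let $$\ket{\Psi}=\xi_1\ket{abcd}+\sum_{(\phi_1,\phi_2)}\xi_2^{\phi_1\phi_2}\ket{ab\phi_1\phi_2}+\sum_{(\phi_3,\phi_4)}\xi_3^{\phi_3\phi_4}\ket{cd\phi_3\phi_4}+\xi_4\ket{wxyz},$$ where the $\xi$'s are arbitrary coefficients and the finite sums run over pairs of distinct orbitals $\phi_i$, none of which belongs to $\{a,b,c,d,w,x,y,z,\eta_1,\eta_2\}$ (so the ancilla orbitals are empty in $\ket{\Psi}$). Then applying to $\ket{\Psi}$ successively (first operator listed acts first) the five operators 1. $U^{w\eta_1}_{ab}(\pi/2)$, 2. $U^{y\eta_2}_{cd}(\pi/2)$, 3. the doubly controlled double $C_{wy}U^{xz}_{\eta_1\eta_2}(\theta)$, 4. $U^{cd}_{y\eta_2}(\pi/2)$, 5. $U^{ab}_{w\eta_1}(\pi/2)$, gives the same state as the quadruple unitary coupled-cluster factor: $$U^{ab}_{w\eta_1}(\tfrac{\pi}{2})\,U^{cd}_{y\eta_2}(\tfrac{\pi}{2})\,C_{wy}U^{xz}_{\eta_1\eta_2}(\theta)\,U^{y\eta_2}_{cd}(\tfrac{\pi}{2})\,U^{w\eta_1}_{ab}(\tfrac{\pi}{2})\ket{\Psi}=e^{\theta\left(\hat A_{abcd}^{wxyz}-(\hat A_{abcd}^{wxyz})^\dagger\right)}\ket{\Psi},$$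 and both sides equal $$\cos\theta\,\xi_1\ket{abcd}+\sin\theta\,\xi_1\ket{wxyz}+\sum_{(\phi_1,\phi_2)}\xi_2^{\phi_1\phi_2}\ket{ab\phi_1\phi_2}+\sum_{(\phi_3,\phi_4)}\xi_3^{\phi_3\phi_4}\ket{cd\phi_3\phi_4}+\cos\theta\,\xi_4\ket{wxyz}-\sin\theta\,\xi_4\ket{abcd}.$$
   Context: Work in the fermionic Fock space over a finite set of spin orbitals with creation and annihilation operators $\hat a_p^\dagger,\hat a_p$ satisfying $\{\hat a_p,\hat a_q\}=0$, $\{\hat a_p^\dagger,\hat a_q^\dagger\}=0$, $\{\hat a_p,\hat a_q^\dagger\}=\delta_{pq}$, vacuum $\ket{\mathrm{vac}}$ and number operators $\hat n_p=\hat a_p^\dagger\hat a_p$. A ket listing orbitals denotes the determinant $\ket{p_1p_2\cdots p_m}=\hat a_{p_1}^\dagger\hat a_{p_2}^\dagger\cdots\hat a_{p_m}^\dagger\ket{\mathrm{vac}}$; all orbitals not listed are empty. For disjoint lists of distinct orbitals $i_1,\dots,i_n$ and $p_1,\dots,p_n$, the rank-$n$ excitation operator is $\hat A_{i_1\cdots i_n}^{p_1\cdots p_n}=\hat a_{p_1}^\dagger\hat a_{p_2}^\dagger\cdots\hat a_{p_n}^\dagger\,\hat a_{i_n}\cdots\hat a_{i_2}\hat a_{i_1}$. The corresponding unitary coupled-cluster (UCC) factor with angle $\theta$ is $U_{i_1\cdots i_n}^{p_1\cdots p_n}(\theta)=\exp\!\big(\theta[\hat A_{i_1\cdots i_n}^{p_1\cdots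 p_n}-(\hat A_{i_1\cdots i_n}^{p_1\cdots p_n})^\dagger]\big)$. The controlled factor $C_{q_1\cdots q_k}U_{i_1\cdots i_n}^{p_1\cdots p_n}(\theta)$, with control orbitals $q_1,\dots,q_k$ distinct from all $i$'s and $p$'s, acts as $U_{i_1\cdots i_n}^{p_1\cdots p_n}(\theta)$ on determinants in which all of $q_1,\dots,q_k$ are occupied, and as the identity on all other determinants; equivalently it is $\exp\!\big(\theta\,\hat n_{q_1}\cdots\hat n_{q_k}[\hat A_{i_1\cdots i_n}^{p_1\cdots p_n}-(\hat A_{i_1\cdots i_n}^{p_1\cdots p_n})^\dagger]\big)$. *)

theory Defs
  imports "HOL-Analysis.Analysis"
begin

section \<open>Fermionic Fock space over a finite type of spin orbitals\<close>

text \<open>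
  The Fock space over the orbitals \<open>'o\<close> is the space of complex vectors indexed by occupation
  sets \<open>S :: 'o set\<close>, and operators are complex matrices over the same index type.
  The ladder operators are given by the Jordan--Wigner formula, whose sign needs some enumeration
  of the orbitals; we take \<open>to_nat\<close>.  The choice is immaterial, since only the
  anticommutation relations (proved below) and the vacuum enter.
\<close>

type_synonym 'o fock = "complex ^ ('o set)"
type_synonym 'o fock_op = "complex ^ ('o set) ^ ('o set)"

definition dagger :: "complex ^ 'n ^ 'm \<Rightarrow> complex ^ 'm ^ 'n" where
  "dagger A = (\<chi> i j. cnj (A $ j $ i))"

definition jw_sign :: "'o::finite \<Rightarrow> 'o set \<Rightarrow> complex" where
  "jw_sign p S = (- 1) ^ card {q \<in> S. to_nat q < to_nat p}"

definition annih :: "'o::finite \<Rightarrow> 'o fock_op" where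
  "annih p = (\<chi> S T. if p \<in> T \<and> S = T - {p} then jw_sign p T else 0)"

definition creat :: "'o::finite \<Rightarrow> 'o fock_op" where
  "creat p = dagger (annih p)"

definition number_op :: "'o::finite \<Rightarrow> 'o fock_op" where
  "number_op p = creat p ** annih p"

definition vac :: "'o::finite fock" where
  "vac = axis {} 1"

definition op_prod :: "'o::finite fock_op list \<Rightarrow> 'o fock_op" where
  "op_prod As = foldr (**) As (mat 1)"

definition ket :: "'o::finite list \<Rightarrow> 'o fock" where
  "ket ps = op_prod (map creat ps) *v vac"

section \<open>Exponentials and unitary coupled-cluster factors\<close>

text \<open>
  The componentwise product makes \<open>complex ^ 'n ^ 'n\<close> a ring with the wrong multiplication, so
  powers are taken with respect to the matrix product \<open>**\<close>.
\<close>

definition mat_power :: "complex ^ 'n ^ 'n \<Rightarrow> nat \<Rightarrow> complex ^ 'n ^ 'n" where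
  "mat_power A n = (((**) A) ^^ n) (mat 1)"

definition mat_exp :: "complex ^ 'n ^ 'n \<Rightarrow> complex ^ 'n ^ 'n" where
  "mat_exp A = (\<Sum>n. mat_power A n /\<^sub>R fact n)"

text \<open>
  In \<open>excitation is ps\<close>, \<open>ucc is ps \<theta>\<close> and \<open>ctrl_ucc qs is ps \<theta>\<close> the list \<open>is\<close> holds the
  lower indices and \<open>ps\<close> the upper ones.
\<close>

definition excitation :: "'o::finite list \<Rightarrow> 'o list \<Rightarrow> 'o fock_op" where
  "excitation is ps = op_prod (map creat ps) ** op_prod (map annih (rev is))"

definition ucc_generator :: "'o::finite list \<Rightarrow> 'o list \<Rightarrow> 'o fock_op" where
  "ucc_generator is ps = excitation is ps - dagger (excitation is ps)"

definition ucc :: "'o::finite list \<Rightarrow> 'o list \<Rightarrow> real \<Rightarrow> 'o fock_op" where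
  "ucc is ps \<theta> = mat_exp (\<theta> *\<^sub>R ucc_generator is ps)"

text \<open>
  Column \<open>T\<close> of a matrix is the image of the determinant occupying exactly \<open>T\<close>.  That this agrees
  with the exponential containing the number operators is lemma \<open>ctrl_ucc_eq_mat_exp\<close>.
\<close>

definition ctrl_ucc :: "'o::finite list \<Rightarrow> 'o list \<Rightarrow> 'o list \<Rightarrow> real \<Rightarrow> 'o fock_op" where
  "ctrl_ucc qs is ps \<theta> =
     (\<chi> S T. if set qs \<subseteq> T then ucc is ps \<theta> $ S $ T else mat 1 $ S $ T)"

section \<open>Canonical anticommutation relations\<close>

lemma mv_axis: "(A :: complex ^ 'n ^ 'm) *v axis T 1 = (\<chi> S. A $ S $ T)"
proof -
  have "(\<Sum>j\<in>UNIV. A $ S $ j * axis T 1 $ j) = (\<Sum>j\<in>UNIV. if j = T then A $ S $ T else 0)" for S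
    by (rule sum.cong) (auto simp: axis_def)
  then show ?thesis by (simp add: matrix_vector_mult_def vec_eq_iff)
qed

lemma matrix_eq_axisI:
  fixes A B :: "complex ^ 'n ^ 'm"
  assumes "\<And>T. A *v axis T 1 = B *v axis T 1"
  shows "A = B"
  using assms by (simp add: mv_axis vec_eq_iff)

lemma annih_axis:
  "annih p *v axis T 1 = (if p \<in> T then jw_sign p T *s axis (T - {p}) 1 else 0)"
  unfolding mv_axis by (auto simp: annih_def vec_eq_iff axis_def)

lemma creat_axis:
  "creat p *v axis T 1 = (if p \<notin> T then jw_sign p T *s axis (insert p T) 1 else 0)"
proof -
  have *: "jw_sign p (insert p T) = jw_sign p T" for T :: "'a set"
    unfolding jw_sign_def by (rule arg_cong[where f = "\<lambda>A. (- 1) ^ card A"]) auto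
  have "cnj (jw_sign p S) = jw_sign p S" for S :: "'a set"
    by (simp add: jw_sign_def)
  then show ?thesis
    using * unfolding mv_axis
    by (auto simp: creat_def dagger_def annih_def vec_eq_iff axis_def)
qed

lemma jw_sign_insert:
  assumes "q \<notin> T"
  shows "jw_sign p (insert q T) = (if to_nat q < to_nat p then - 1 else 1) * jw_sign p T"
proof -
  have "{r \<in> insert q T. to_nat r < to_nat p} =
    (if to_nat q < to_nat p then insert q {r \<in> T. to_nat r < to_nat p}
     else {r \<in> T. to_nat r < to_nat p})" by auto
  then show ?thesis using assms by (simp add: jw_sign_def)
qed

lemma jw_sign_remove:
  assumes "q \<in> T"
  shows "jw_sign p (T - {q}) = (if to_nat q < to_nat p then - 1 else 1) * jw_sign p T"
  using jw_sign_insert[of q "T - {q}" p] assms by (simp add: insert_absorb)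

lemma jw_sign_square [simp]: "jw_sign p T * jw_sign p T = 1"
  by (simp add: jw_sign_def flip: power_mult_distrib)

lemma to_nat_neq_cases: "(p :: 'o::finite) \<noteq> q \<Longrightarrow> to_nat p < to_nat q \<or> to_nat q < to_nat p"
  by (metis inj_to_nat injD linorder_neqE_nat)

lemma mv_smult: "(A :: complex ^ 'n ^ 'm) *v (c *s v) = c *s (A *v v)"
  by (simp add: vector_scalar_commute)

lemma annih_annih: "annih p ** annih q + annih q ** annih p = 0"
proof (rule matrix_eq_axisI)
  fix T
  show "(annih p ** annih q + annih q ** annih p) *v axis T 1 = 0 *v axis T 1"
  proof (cases "p = q")
    case True
    have "annih q *v (annih q *v axis T 1) = 0"
      by (simp add: annih_axis mv_smult)
    with True show ?thesis
      by (simp only: matrix_vector_mult_add_rdistrib flip: matrix_vector_mul_assoc) simp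
  next
    case False
    have "T - {q} - {p} = T - {p} - {q}" by auto
    with False to_nat_neq_cases[OF False] show ?thesis
      by (auto simp: matrix_vector_mult_add_rdistrib annih_axis mv_smult jw_sign_remove
        vec_eq_iff simp flip: matrix_vector_mul_assoc)
  qed
qed

lemma dagger_mult: "dagger (A ** B) = dagger B ** dagger A"
  by (simp add: dagger_def matrix_matrix_mult_def vec_eq_iff mult.commute)

lemma dagger_add: "dagger (A + B) = dagger A + dagger B"
  by (simp add: dagger_def vec_eq_iff)

lemma creat_creat: "creat p ** creat q + creat q ** creat p = 0"
proof -
  have "dagger (annih q ** annih p + annih p ** annih q) = dagger 0"
    by (simp only: annih_annih)
  then show ?thesis
    by (simp add: dagger_add dagger_mult creat_def) (simp add: dagger_def vec_eq_iff)
qed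

lemma annih_creat: "annih p ** creat q + creat q ** annih p = (if p = q then mat 1 else 0)"
proof (rule matrix_eq_axisI)
  fix T
  show "(annih p ** creat q + creat q ** annih p) *v axis T 1
    = (if p = q then mat 1 else 0) *v axis T 1"
  proof (cases "p = q")
    case True
    then show ?thesis
      by (cases "p \<in> T") (auto simp: matrix_vector_mult_add_rdistrib annih_axis creat_axis mv_smult
        jw_sign_remove jw_sign_insert insert_absorb simp flip: matrix_vector_mul_assoc)
  next
    case False
    have "insert q T - {p} = insert q (T - {p})" using False by auto
    with False to_nat_neq_cases[OF False] show ?thesis
      by (auto simp: matrix_vector_mult_add_rdistrib annih_axis creat_axis mv_smult jw_sign_remove
        jw_sign_insert vec_eq_iff simp flip: matrix_vector_mul_assoc)
  qed
qed

lemma annih_vac: "annih p *v vac = 0"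
  by (simp add: vac_def annih_axis)

section \<open>Convergence of the exponential, and the controlled factor as an exponential\<close>

lemma mat_power_0 [simp]: "mat_power A 0 = mat 1"
  and mat_power_Suc [simp]: "mat_power A (Suc n) = A ** mat_power A n"
  by (simp_all add: mat_power_def)

lemma summable_mat_exp: "summable (\<lambda>n. mat_power A n /\<^sub>R fact n)"
proof -
  have "linear (\<lambda>B :: complex ^ 'a ^ 'a. A ** B)"
    by (rule linearI)
      (auto simp: matrix_add_ldistrib, simp add: matrix_matrix_mult_def vec_eq_iff scaleR_sum_right)
  then obtain C where C: "0 < C" "\<And>B :: complex ^ 'a ^ 'a. norm (A ** B) \<le> C * norm B"
    using linear_bounded_pos by blast
  have bound: "norm (mat_power A n) \<le> C ^ n * norm (mat 1 :: complex^'a^'a)" for n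
  proof (induction n)
    case (Suc n)
    have "norm (mat_power A (Suc n)) \<le> C * norm (mat_power A n)" using C by simp
    also have "\<dots> \<le> C * (C ^ n * norm (mat 1 :: complex^'a^'a))"
      using C Suc by (intro mult_left_mono) auto
    finally show ?case by (simp add: mult.assoc)
  qed simp
  show ?thesis
  proof (rule summable_comparison_test')
    show "summable (\<lambda>n. (C ^ n /\<^sub>R fact n) * norm (mat 1 :: complex^'a^'a))"
      by (intro summable_mult2 summable_exp_generic)
    fix n :: nat
    show "norm (mat_power A n /\<^sub>R fact n) \<le> (C ^ n /\<^sub>R fact n) * norm (mat 1 :: complex^'a^'a)"
      using bound[of n] by (simp add: divide_simps)
  qed
qed

lemma mat_exp_nth: "mat_exp A $ i $ j = (\<Sum>n. mat_power A n $ i $ j /\<^sub>R fact n)"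
proof -
  have "bounded_linear (\<lambda>M :: complex^'a^'a. M $ i $ j)"
    by (rule bounded_linear_compose[OF bounded_linear_vec_nth bounded_linear_vec_nth])
  from bounded_linear.suminf[OF this summable_mat_exp[of A]] show ?thesis
    by (simp add: mat_exp_def)
qed

definition preserves_occ :: "'o set \<Rightarrow> 'o::finite fock_op \<Rightarrow> bool" where
  "preserves_occ Q A \<longleftrightarrow> (\<forall>S T. A $ S $ T \<noteq> 0 \<longrightarrow> S \<inter> Q = T \<inter> Q)"

lemma preserves_occ_mult:
  assumes "preserves_occ Q A" "preserves_occ Q B"
  shows "preserves_occ Q (A ** B)"
  unfolding preserves_occ_def
proof (intro allI impI)
  fix S T assume "(A ** B) $ S $ T \<noteq> 0"
  then have "(\<Sum>k\<in>UNIV. A $ S $ k * B $ k $ T) \<noteq> 0"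
    by (simp add: matrix_matrix_mult_def)
  then obtain k where "A $ S $ k * B $ k $ T \<noteq> 0" by (meson sum.neutral)
  with assms show "S \<inter> Q = T \<inter> Q" unfolding preserves_occ_def by fastforce
qed

lemma preserves_occ_dagger: "preserves_occ Q A \<Longrightarrow> preserves_occ Q (dagger A)"
  unfolding preserves_occ_def dagger_def by simp

lemma preserves_occ_annih: "p \<notin> Q \<Longrightarrow> preserves_occ Q (annih p)"
  unfolding preserves_occ_def annih_def by auto

lemma preserves_occ_op_prod:
  "\<forall>A \<in> set As. preserves_occ Q A \<Longrightarrow> preserves_occ Q (op_prod As)"
proof (induction As)
  case Nil
  then show ?case by (simp add: op_prod_def preserves_occ_def mat_def)
next
  case (Cons A As)
  then show ?case by (simp add: op_prod_def preserves_occ_mult)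
qed

lemma preserves_occ_ucc_generator:
  assumes "Q \<inter> (set is \<union> set ps) = {}"
  shows "preserves_occ Q (ucc_generator is ps)"
proof -
  have "preserves_occ Q (excitation is ps)"
    unfolding excitation_def creat_def using assms
    by (auto intro!: preserves_occ_mult preserves_occ_op_prod preserves_occ_dagger
      preserves_occ_annih)
  moreover from preserves_occ_dagger[OF this]
  have "preserves_occ Q (dagger (excitation is ps))" .
  ultimately show ?thesis
    unfolding ucc_generator_def preserves_occ_def
    by (metis diff_0_right vector_minus_component)
qed

lemma number_op_axis: "number_op p *v axis T 1 = (if p \<in> T then axis T 1 else 0)"
  by (auto simp: number_op_def annih_axis creat_axis mv_smult jw_sign_remove insert_absorb
    simp flip: matrix_vector_mul_assoc)

lemma op_prod_number_op_axis:
  "op_prod (map number_op qs) *v axis T 1 = (if set qs \<subseteq> T then axis T 1 else 0)"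
proof (induction qs)
  case Nil
  then show ?case by (simp add: op_prod_def)
next
  case (Cons q qs)
  have "op_prod (map number_op (q # qs)) *v axis T 1
    = number_op q *v (op_prod (map number_op qs) *v axis T 1)"
    by (simp add: op_prod_def matrix_vector_mul_assoc)
  with Cons show ?case by (simp add: number_op_axis)
qed

lemma op_prod_number_op_nth:
  "op_prod (map number_op qs) $ S $ T = (if S = T \<and> set qs \<subseteq> T then 1 else 0)"
proof -
  have "op_prod (map number_op qs) $ S $ T = (op_prod (map number_op qs) *v axis T 1) $ S"
    by (simp add: mv_axis)
  then show ?thesis unfolding op_prod_number_op_axis by (auto simp: axis_def)
qed

lemma ctrl_ucc_eq_mat_exp:
  assumes "set qs \<inter> (set is \<union> set ps) = {}"
  shows "ctrl_ucc qs is ps \<theta>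
    = mat_exp (\<theta> *\<^sub>R (op_prod (map number_op qs) ** ucc_generator is ps))"
proof -
  define K where "K = \<theta> *\<^sub>R ucc_generator is ps"
  define L where "L = \<theta> *\<^sub>R (op_prod (map number_op qs) ** ucc_generator is ps)"
  have K: "preserves_occ (set qs) K"
    using preserves_occ_ucc_generator[OF assms] by (simp add: K_def preserves_occ_def)
  have Kpow: "preserves_occ (set qs) (mat_power K n)" for n
    by (induction n) (simp_all add: preserves_occ_mult K, simp add: preserves_occ_def mat_def)
  have L1: "L $ S $ T = (if set qs \<subseteq> S then K $ S $ T else 0)" for S T
  proof -
    have "(op_prod (map number_op qs) ** ucc_generator is ps) $ S $ T
      = (\<Sum>k\<in>UNIV. if k = S then (if set qs \<subseteq> S then ucc_generator is ps $ S $ T else 0) else 0)"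
      unfolding matrix_matrix_mult_def op_prod_number_op_nth
      by (simp only: vec_lambda_beta, intro sum.cong) auto
    then show ?thesis by (simp add: L_def K_def)
  qed
  have Lin: "mat_power L n $ S $ T = mat_power K n $ S $ T" if "set qs \<subseteq> T" for n S T
  proof (induction n arbitrary: S)
    case (Suc n)
    have "L $ S $ R * mat_power K n $ R $ T = K $ S $ R * mat_power K n $ R $ T" for R
    proof (cases "K $ S $ R * mat_power K n $ R $ T = 0")
      case False
      then have "S \<inter> set qs = R \<inter> set qs" "R \<inter> set qs = T \<inter> set qs"
        using K Kpow[of n] unfolding preserves_occ_def by auto
      then show ?thesis using that L1 by auto
    qed (auto simp: L1)
    then have "(\<Sum>R\<in>UNIV. L $ S $ R * mat_power K n $ R $ T)
      = (\<Sum>R\<in>UNIV. K $ S $ R * mat_power K n $ R $ T)" by (intro sum.cong) auto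
    with Suc show ?case by (simp add: matrix_matrix_mult_def)
  qed simp
  have L0: "mat_power L (Suc n) $ S $ T = 0" if "\<not> set qs \<subseteq> T" for n S T
  proof (induction n arbitrary: S)
    case 0
    have "L $ S $ T = 0"
      using that L1[of S T] K unfolding preserves_occ_def by (metis Int_absorb1 inf_le1)
    then show ?case by simp
  next
    case (Suc n)
    have "mat_power L (Suc (Suc n)) $ S $ T = (\<Sum>R\<in>UNIV. L $ S $ R * mat_power L (Suc n) $ R $ T)"
      by (subst mat_power_Suc) (simp add: matrix_matrix_mult_def)
    with Suc show ?case by simp
  qed
  have "mat_exp L $ S $ T = ctrl_ucc qs is ps \<theta> $ S $ T" for S T
  proof (cases "set qs \<subseteq> T")
    case True
    then show ?thesis by (simp add: ctrl_ucc_def ucc_def mat_exp_nth Lin flip: K_def)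
  next
    case False
    have "(\<lambda>n. mat_power L n $ S $ T /\<^sub>R fact n) sums (mat_power L 0 $ S $ T /\<^sub>R fact 0)"
    proof -
      have "(\<lambda>n. mat_power L n $ S $ T /\<^sub>R fact n) sums
        (\<Sum>n\<in>{0}. mat_power L n $ S $ T /\<^sub>R fact n)"
        by (rule sums_finite) (use L0[OF False] in \<open>auto simp del: mat_power_Suc simp: gr0_conv_Suc\<close>)
      then show ?thesis by simp
    qed
    with False show ?thesis by (simp add: ctrl_ucc_def mat_exp_nth sums_iff)
  qed
  then show ?thesis by (simp add: vec_eq_iff L_def)
qed

end

theory Submission
  imports Defs
begin

text \<open>
  Each generator \<open>G = A - A\<^sup>\<dagger>\<close> either kills a determinant or rotates a pair of
  determinants, \<open>G v = u\<close> and \<open>G u = - v\<close>; then \<open>v \<mp> \<i> u\<close> are eigenvectors of \<open>G\<close> for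
  \<open>\<plusminus> \<i>\<close>, so \<open>exp (\<theta> G)\<close> is a rotation by \<open>\<theta>\<close>.  The first two factors turn \<open>abcd\<close> into
  \<open>w \<eta>1 y \<eta>2\<close>, the controlled double rotates this determinant with \<open>wxyz\<close>, and the last two factors
  undo the first two.  The determinants with \<open>\<phi>\<close>'s reach the controlled factor with one of the
  controls \<open>w\<close>, \<open>y\<close> empty, hence they are only moved back and forth.
\<close>

section \<open>Exponentials on invariant planes\<close>

text \<open>Powers of \<open>A\<close> scale \<open>e\<close> by powers of \<open>l\<close>.
  Evaluation at \<open>e\<close> and scaling of \<open>e\<close> are bounded linear, so the matrix
  series and the scalar series of \<open>exp l\<close> can be compared termwise.\<close>

lemma mat_exp_eigenvector:
  fixes A :: "complex ^ 'n ^ 'n"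
  assumes "A *v e = l *s e"
  shows "mat_exp A *v e = exp l *s e"
proof -
  have pow: "mat_power A n *v e = l ^ n *s e" for n
    by (induction n) (simp_all add: assms mv_smult mult.commute flip: matrix_vector_mul_assoc)
  have lin: "bounded_linear (\<lambda>M :: complex^'n^'n. M *v e)"
    by (intro linear_conv_bounded_linear[THEN iffD1] linearI)
      (auto simp: matrix_vector_mult_def vec_eq_iff scaleR_sum_right sum.distrib distrib_right)
  have "(\<lambda>n. (mat_power A n /\<^sub>R fact n) *v e) sums (mat_exp A *v e)"
    unfolding mat_exp_def
    by (intro bounded_linear.sums[OF lin] summable_sums summable_mat_exp)
  moreover have "(mat_power A n /\<^sub>R fact n) *v e = (l ^ n /\<^sub>R fact n) *s e" for n
    using linear_scale[OF bounded_linear.linear[OF lin], of "inverse (fact n)" "mat_power A n"] pow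
    by (simp add: vec_eq_iff)
  moreover have "bounded_linear (\<lambda>c. c *s e)"
    by (intro linear_conv_bounded_linear[THEN iffD1] linearI) (auto simp: vec_eq_iff distrib_right)
  from bounded_linear.sums[OF this exp_converges]
  have "(\<lambda>n. (l ^ n /\<^sub>R fact n) *s e) sums (exp l *s e)" .
  ultimately show ?thesis by (simp add: sums_unique2)
qed

lemma scaleR_mv: "(t *\<^sub>R A) *v v = of_real t *s ((A :: complex ^ 'n ^ 'm) *v v)"
  by (simp add: matrix_vector_mult_def vec_eq_iff sum_distrib_left)
    (simp add: scaleR_conv_of_real mult.assoc)

lemma mat_exp_kernel:
  fixes G :: "complex ^ 'n ^ 'n"
  assumes "G *v v = 0"
  shows "mat_exp (\<theta> *\<^sub>R G) *v v = v"
  using mat_exp_eigenvector[of "\<theta> *\<^sub>R G" v 0] assms by (simp add: scaleR_mv)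

lemma mat_exp_rotation:
  fixes G :: "complex ^ 'n ^ 'n"
  assumes v: "G *v v = u" and u: "G *v u = - v"
  shows "mat_exp (\<theta> *\<^sub>R G) *v v = of_real (cos \<theta>) *s v + of_real (sin \<theta>) *s u"
proof -
  \<comment> \<open>Both eigenvectors at once: \<open>s\<close> stands for either square root of -1
    and is itself the eigenvalue.\<close>
  have eig: "mat_exp (\<theta> *\<^sub>R G) *v (v - s *s u) = exp (of_real \<theta> * s) *s (v - s *s u)"
    if "s * s = - 1" for s
  proof (rule mat_exp_eigenvector)
    have "s *s (v - s *s u) = u + s *s v"
      using that by (simp add: vec_eq_iff algebra_simps flip: mult.assoc)
    then have "G *v (v - s *s u) = s *s (v - s *s u)"
      by (simp add: matrix_vector_mult_diff_distrib mv_smult v u vec_eq_iff)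
    then show "(\<theta> *\<^sub>R G) *v (v - s *s u) = (of_real \<theta> * s) *s (v - s *s u)"
      by (simp add: scaleR_mv)
  qed
  \<comment> \<open>Averaging the two eigenvectors recovers \<open>v\<close>; Euler's formula then
    turns the two phases into cosine and sine.\<close>
  have "v = (1/2) *s ((v - \<i> *s u) + (v - (- \<i>) *s u))"
    by (simp add: vec_eq_iff)
  then have "mat_exp (\<theta> *\<^sub>R G) *v v
    = (1/2) *s (mat_exp (\<theta> *\<^sub>R G) *v (v - \<i> *s u) + mat_exp (\<theta> *\<^sub>R G) *v (v - (- \<i>) *s u))"
    by (metis mv_smult matrix_vector_right_distrib)
  also have "\<dots> = (1/2) *s (exp (of_real \<theta> * \<i>) *s (v - \<i> *s u)
      + exp (of_real \<theta> * (- \<i>)) *s (v - (- \<i>) *s u))"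
    by (simp only: eig[of \<i>] eig[of "- \<i>"] i_squared minus_mult_minus)
  also have "\<dots> = of_real (cos \<theta>) *s v + of_real (sin \<theta>) *s u"
    by (simp add: vec_eq_iff exp_eq_polar complex_eq_iff Re_exp Im_exp field_simps)
  finally show ?thesis .
qed

section \<open>Determinants\<close>

lemma mv_sum: "(A :: complex ^ 'n ^ 'm) *v sum f S = (\<Sum>i\<in>S. A *v f i)"
  by (induction S rule: infinite_finite_induct) (simp_all add: matrix_vector_right_distrib)

lemma mv_minus: "(A :: complex ^ 'n ^ 'm) *v (- v) = - (A *v v)"
  using matrix_vector_mult_diff_distrib[of A 0 v] by simp

lemma op_prod_Nil [simp]: "op_prod [] = mat 1"
  and op_prod_Cons [simp]: "op_prod (A # As) = A ** op_prod As"
  by (simp_all add: op_prod_def)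

lemma op_prod_append: "op_prod (As @ Bs) = op_prod As ** op_prod Bs"
  by (induction As) (simp_all add: matrix_mul_assoc)

lemma dagger_dagger: "dagger (dagger A) = A"
  by (simp add: dagger_def vec_eq_iff)

lemma dagger_op_prod: "dagger (op_prod As) = op_prod (rev (map dagger As))"
  by (induction As)
    (auto simp: dagger_mult op_prod_append, auto simp: dagger_def mat_def vec_eq_iff)

text \<open>The adjoint reverses the order of factors, and the annihilators are already listed in
  reverse, so the two index lists trade places without a sign.\<close>

lemma dagger_excitation: "dagger (excitation is ps) = excitation ps is"
proof -
  have "dagger (annih p) = creat p" "dagger (creat p) = annih p" for p :: 'a
    by (simp_all add: creat_def dagger_dagger)
  then show ?thesis by (simp add: excitation_def dagger_mult dagger_op_prod rev_map comp_def)
qed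

section \<open>Antisymmetry of kets and annihilation\<close>

lemma ket_Cons: "ket (p # L) = creat p *v ket L"
  by (simp add: ket_def matrix_vector_mul_assoc)

lemma op_prod_creat_ket: "op_prod (map creat ps) *v ket L = ket (ps @ L)"
  by (simp add: ket_def op_prod_append matrix_vector_mul_assoc)

lemma ket_swap: "ket (p # q # L) = - ket (q # p # L)"
proof -
  have "ket (p # q # L) + ket (q # p # L) = (creat p ** creat q + creat q ** creat p) *v ket L"
    by (simp add: ket_Cons matrix_vector_mult_add_rdistrib matrix_vector_mul_assoc)
  then show ?thesis by (simp add: creat_creat eq_neg_iff_add_eq_0)
qed

lemma ket_swap2: "ket (o1 # p # q # L) = - ket (o1 # q # p # L)"
  using ket_swap[of p q L] by (simp add: ket_Cons[of o1] mv_minus)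

text \<open>Moving one pair past another costs four transpositions, so the signs cancel.\<close>

lemma ket_pair_commute: "ket (p # q # r # s # L) = ket (r # s # p # q # L)"
  by (metis ket_Cons ket_swap ket_swap2)

text \<open>Anticommuting past the first creator gives a recursion along the list, so annihilators
  can be evaluated on kets without Jordan-Wigner signs.\<close>

lemma annih_ket_Cons:
  "annih p *v ket (q # L) = (if p = q then ket L else 0) - creat q *v (annih p *v ket L)"
proof -
  have "annih p *v ket (q # L) + creat q *v (annih p *v ket L)
    = (annih p ** creat q + creat q ** annih p) *v ket L"
    by (simp add: ket_Cons matrix_vector_mult_add_rdistrib matrix_vector_mul_assoc)
  then show ?thesis by (simp add: annih_creat eq_diff_eq)
qed

lemma annih_ket_empty: "p \<notin> set L \<Longrightarrow> annih p *v ket L = 0"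
proof (induction L)
  case Nil
  then show ?case by (simp add: ket_def annih_vac)
qed (simp add: annih_ket_Cons)

text \<open>Bridge to \<open>ctrl_ucc\<close>, which is defined by its columns: by linearity, facts
  about occupation basis vectors carry over to kets.\<close>

lemma ket_proportional_axis: "\<exists>k. ket L = k *s axis (set L) 1"
proof (induction L)
  case Nil
  then show ?case by (intro exI[of _ 1]) (simp add: ket_def vac_def)
next
  case (Cons p L)
  then obtain k where k: "ket L = k *s axis (set L) 1" by blast
  show ?case
  proof (cases "p \<in> set L")
    case True
    then show ?thesis by (intro exI[of _ 0]) (simp add: ket_Cons k mv_smult creat_axis)
  next
    case False
    then show ?thesis
      by (intro exI[of _ "k * jw_sign p (set L)"]) (simp add: ket_Cons k mv_smult creat_axis)
  qed
qed

section \<open>Unitary coupled-cluster factors on determinants\<close>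

text \<open>Because of \<open>rev\<close>, the head of \<open>is\<close> is annihilated first, so
  each annihilator meets its own creator at the front and no sign arises.\<close>

lemma annihilators_ket:
  "distinct (is @ L) \<Longrightarrow> op_prod (map annih (rev is)) *v ket (is @ L) = ket L"
proof (induction "is" arbitrary: L)
  case (Cons i "is")
  then show ?case
    by (simp add: op_prod_append annih_ket_Cons annih_ket_empty flip: matrix_vector_mul_assoc)
qed simp

text \<open>By anticommutation the kernel of \<open>annih p\<close> is stable under every
  annihilator. A vector killed by \<open>annih p\<close> therefore stays so until that factor of the
  product is reached.\<close>

lemma annih_annihilators:
  assumes "annih p *v v = 0"
  shows "annih p *v (op_prod (map annih js) *v v) = 0"
proof (induction js)
  case (Cons j js)
  let ?u = "op_prod (map annih js) *v v"
  have "(annih p ** annih j + annih j ** annih p) *v ?u = 0" by (simp add: annih_annih)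
  then show ?case
    using Cons by (simp add: matrix_vector_mult_add_rdistrib flip: matrix_vector_mul_assoc)
qed (simp add: assms)

lemma annihilators_zero:
  assumes "annih p *v v = 0" "p \<in> set js"
  shows "op_prod (map annih js) *v v = 0"
  using assms(2)
proof (induction js)
  case (Cons j js)
  then show ?case
    using annih_annihilators[OF assms(1)] by (auto simp flip: matrix_vector_mul_assoc)
qed simp

lemma excitation_ket:
  "distinct (is @ L) \<Longrightarrow> excitation is ps *v ket (is @ L) = ket (ps @ L)"
  by (simp add: excitation_def annihilators_ket op_prod_creat_ket flip: matrix_vector_mul_assoc)

lemma excitation_ket_zero:
  assumes "\<not> set is \<subseteq> set L"
  shows "excitation is ps *v ket L = 0"
proof -
  obtain i where "i \<in> set is" "i \<notin> set L" using assms by blast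
  then have "op_prod (map annih (rev is)) *v ket L = 0"
    by (intro annihilators_zero[of i] annih_ket_empty) auto
  then show ?thesis by (simp add: excitation_def flip: matrix_vector_mul_assoc)
qed

lemma ucc_generator_mv: "ucc_generator is ps *v v = excitation is ps *v v - excitation ps is *v v"
  by (simp add: ucc_generator_def dagger_excitation matrix_vector_mult_diff_rdistrib)

text \<open>The excitation lacks an occupied lower orbital and its adjoint an occupied upper one, so
  the generator kills the ket.\<close>

lemma ucc_ket_idle:
  assumes "\<not> set is \<subseteq> set L" "\<not> set ps \<subseteq> set L"
  shows "ucc is ps \<theta> *v ket L = ket L"
  unfolding ucc_def by (rule mat_exp_kernel) (simp add: ucc_generator_mv excitation_ket_zero assms)

lemma
  assumes "distinct (is @ ps @ L)" "is \<noteq> []" "ps \<noteq> []"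
  shows ucc_ket_lower: "ucc is ps \<theta> *v ket (is @ L)
      = of_real (cos \<theta>) *s ket (is @ L) + of_real (sin \<theta>) *s ket (ps @ L)"
    and ucc_ket_upper: "ucc is ps \<theta> *v ket (ps @ L)
      = of_real (cos \<theta>) *s ket (ps @ L) - of_real (sin \<theta>) *s ket (is @ L)"
proof -
  \<comment> \<open>Disjoint nonempty lists: on each of the two kets exactly one of the excitation
    and its adjoint survives.\<close>
  have "\<not> set is \<subseteq> set (ps @ L)" "\<not> set ps \<subseteq> set (is @ L)"
    using assms by (auto simp: neq_Nil_conv)
  moreover have "distinct (is @ L)" "distinct (ps @ L)" using assms(1) by auto
  ultimately have G: "ucc_generator is ps *v ket (is @ L) = ket (ps @ L)"
      "ucc_generator is ps *v ket (ps @ L) = - ket (is @ L)"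
    by (simp_all only: ucc_generator_mv excitation_ket excitation_ket_zero simp_thms
        diff_0_right diff_0)
  show "ucc is ps \<theta> *v ket (is @ L)
      = of_real (cos \<theta>) *s ket (is @ L) + of_real (sin \<theta>) *s ket (ps @ L)"
    unfolding ucc_def by (rule mat_exp_rotation) (fact G)+
  \<comment> \<open>The same rotation, started a quarter turn later: its second vector is now
    \<open>- ket (is @ L)\<close>.\<close>
  have "ucc is ps \<theta> *v ket (ps @ L)
      = of_real (cos \<theta>) *s ket (ps @ L) + of_real (sin \<theta>) *s (- ket (is @ L))"
    unfolding ucc_def by (rule mat_exp_rotation) (simp_all only: G mv_minus)
  then show "ucc is ps \<theta> *v ket (ps @ L)
      = of_real (cos \<theta>) *s ket (ps @ L) - of_real (sin \<theta>) *s ket (is @ L)"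
    by (simp add: vec_eq_iff)
qed

lemma ctrl_ucc_ket:
  "ctrl_ucc qs is ps \<theta> *v ket L = (if set qs \<subseteq> set L then ucc is ps \<theta> *v ket L else ket L)"
proof -
  have col: "ctrl_ucc qs is ps \<theta> *v axis T 1
      = (if set qs \<subseteq> T then ucc is ps \<theta> *v axis T 1 else mat 1 *v axis T 1)" for T
    by (simp only: mv_axis) (simp add: ctrl_ucc_def vec_eq_iff)
  obtain k where "ket L = k *s axis (set L) 1" using ket_proportional_axis by blast
  then show ?thesis by (simp add: mv_smult col)
qed

section \<open>The five-factor decomposition of the quadruple factor\<close>

theorem mainTheorem1:
  fixes a b c d w x y z \<eta>1 \<eta>2 :: "'o::finite"
    and \<theta> :: real
    and \<xi>1 \<xi>4 :: complex
    and \<xi>2 \<xi>3 :: "'o \<Rightarrow> 'o \<Rightarrow> complex"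
    and P12 P34 :: "('o \<times> 'o) set"
    and \<Psi> :: "'o fock"
  assumes orbitals: "distinct [a, b, c, d, w, x, y, z, \<eta>1, \<eta>2]"
    and pairs: "\<And>\<phi> \<phi>'. (\<phi>, \<phi>') \<in> P12 \<union> P34 \<Longrightarrow>
        \<phi> \<noteq> \<phi>' \<and> {\<phi>, \<phi>'} \<inter> {a, b, c, d, w, x, y, z, \<eta>1, \<eta>2} = {}"
    and Psi: "\<Psi> = \<xi>1 *s ket [a, b, c, d]
        + (\<Sum>(\<phi>1, \<phi>2)\<in>P12. \<xi>2 \<phi>1 \<phi>2 *s ket [a, b, \<phi>1, \<phi>2])
        + (\<Sum>(\<phi>3, \<phi>4)\<in>P34. \<xi>3 \<phi>3 \<phi>4 *s ket [c, d, \<phi>3, \<phi>4])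
        + \<xi>4 *s ket [w, x, y, z]"
  shows "ucc [w, \<eta>1] [a, b] (pi / 2) *v (ucc [y, \<eta>2] [c, d] (pi / 2) *v
          (ctrl_ucc [w, y] [\<eta>1, \<eta>2] [x, z] \<theta> *v
          (ucc [c, d] [y, \<eta>2] (pi / 2) *v (ucc [a, b] [w, \<eta>1] (pi / 2) *v \<Psi>))))
        = mat_exp (\<theta> *\<^sub>R (excitation [a, b, c, d] [w, x, y, z]
            - dagger (excitation [a, b, c, d] [w, x, y, z]))) *v \<Psi>
    \<and> mat_exp (\<theta> *\<^sub>R (excitation [a, b, c, d] [w, x, y, z]
            - dagger (excitation [a, b, c, d] [w, x, y, z]))) *v \<Psi>
        = (of_real (cos \<theta>) * \<xi>1) *s ket [a, b, c, d]
        + (of_real (sin \<theta>) * \<xi>1) *s ket [w, x, y, z]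
        + (\<Sum>(\<phi>1, \<phi>2)\<in>P12. \<xi>2 \<phi>1 \<phi>2 *s ket [a, b, \<phi>1, \<phi>2])
        + (\<Sum>(\<phi>3, \<phi>4)\<in>P34. \<xi>3 \<phi>3 \<phi>4 *s ket [c, d, \<phi>3, \<phi>4])
        + (of_real (cos \<theta>) * \<xi>4) *s ket [w, x, y, z]
        - (of_real (sin \<theta>) * \<xi>4) *s ket [a, b, c, d]"
proof -
  let ?U1 = "ucc [a, b] [w, \<eta>1] (pi / 2)" and ?U2 = "ucc [c, d] [y, \<eta>2] (pi / 2)"
  let ?C = "ctrl_ucc [w, y] [\<eta>1, \<eta>2] [x, z] \<theta>"
  let ?U4 = "ucc [y, \<eta>2] [c, d] (pi / 2)" and ?U5 = "ucc [w, \<eta>1] [a, b] (pi / 2)"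
  let ?co = "of_real (cos \<theta>) :: complex" and ?si = "of_real (sin \<theta>) :: complex"
  define Q where "Q = ucc [a, b, c, d] [w, x, y, z] \<theta>"
  define V where "V = ?U5 ** (?U4 ** (?C ** (?U2 ** ?U1)))"
  have V: "V *v v = ?U5 *v (?U4 *v (?C *v (?U2 *v (?U1 *v v))))" for v
    by (simp add: V_def matrix_vector_mul_assoc)
  have Q: "Q = mat_exp (\<theta> *\<^sub>R (excitation [a, b, c, d] [w, x, y, z]
      - dagger (excitation [a, b, c, d] [w, x, y, z])))"
    by (simp add: Q_def ucc_def ucc_generator_def)
  have Q_abcd: "Q *v ket [a, b, c, d] = ?co *s ket [a, b, c, d] + ?si *s ket [w, x, y, z]"
    and Q_wxyz: "Q *v ket [w, x, y, z] = ?co *s ket [w, x, y, z] - ?si *s ket [a, b, c, d]"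
    using orbitals ucc_ket_lower[of "[a, b, c, d]" "[w, x, y, z]" "[]" \<theta>]
      ucc_ket_upper[of "[a, b, c, d]" "[w, x, y, z]" "[]" \<theta>] by (auto simp: Q_def)

  \<comment> \<open>At angle \<open>pi / 2\<close> the cosine is 0 and the sine is 1, so the factor
    replaces the leading pair with sign +1. The factors that undo this have the lists exchanged, so
    they too move lower to upper and produce no minus sign.\<close>
  have U1: "?U1 *v ket (a # b # L) = ket (w # \<eta>1 # L)"
    and U5: "?U5 *v ket (w # \<eta>1 # L) = ket (a # b # L)"
    if "distinct ([a, b, w, \<eta>1] @ L)" for L
    using that ucc_ket_lower[of "[a, b]" "[w, \<eta>1]" L "pi / 2"]
      ucc_ket_lower[of "[w, \<eta>1]" "[a, b]" L "pi / 2"] by auto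
  have U2: "?U2 *v ket (c # d # L) = ket (y # \<eta>2 # L)"
    and U4: "?U4 *v ket (y # \<eta>2 # L) = ket (c # d # L)"
    if "distinct ([c, d, y, \<eta>2] @ L)" for L
    using that ucc_ket_lower[of "[c, d]" "[y, \<eta>2]" L "pi / 2"]
      ucc_ket_lower[of "[y, \<eta>2]" "[c, d]" L "pi / 2"] by auto

  \<comment> \<open>The controlled rotation needs its active pair in front of the controls. One
    middle transposition and an even exchange of pairs achieve this, with the same sign for both
    kets, so the rotation keeps its direction.\<close>
  have reorder: "ket [w, \<eta>1, y, \<eta>2] = - ket [\<eta>1, \<eta>2, w, y]"
    "ket [w, x, y, z] = - ket [x, z, w, y]"
    by (metis ket_swap2 ket_pair_commute)+
  have C_ancillas: "?C *v ket [w, \<eta>1, y, \<eta>2] = ?co *s ket [w, \<eta>1, y, \<eta>2] + ?si *s ket [w, x, y, z]"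
    unfolding reorder mv_minus ctrl_ucc_ket
    using orbitals ucc_ket_lower[of "[\<eta>1, \<eta>2]" "[x, z]" "[w, y]" \<theta>]
    by (auto simp: vec_eq_iff)
  have C_wxyz: "?C *v ket [w, x, y, z] = ?co *s ket [w, x, y, z] - ?si *s ket [w, \<eta>1, y, \<eta>2]"
    unfolding reorder mv_minus ctrl_ucc_ket
    using orbitals ucc_ket_upper[of "[\<eta>1, \<eta>2]" "[x, z]" "[w, y]" \<theta>]
    by (auto simp: vec_eq_iff)

  have disj: "distinct ([a, b, w, \<eta>1] @ [c, d])" "distinct ([c, d, y, \<eta>2] @ [w, \<eta>1])"
    using orbitals by auto
  \<comment> \<open>After \<open>?U1\<close> the pair \<open>c\<close>, \<open>d\<close> is in
    second place; pair exchanges bring it to the front for \<open>?U2\<close> and restore the order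
    afterwards.\<close>
  have transfer: "?U2 *v (?U1 *v ket [a, b, c, d]) = ket [w, \<eta>1, y, \<eta>2]"
    by (simp only: U1[OF disj(1)] U2[OF disj(2)] ket_pair_commute[of w \<eta>1])
  have restore: "?U5 *v (?U4 *v ket [w, \<eta>1, y, \<eta>2]) = ket [a, b, c, d]"
    by (simp only: U4[OF disj(2)] U5[OF disj(1)] ket_pair_commute[of w \<eta>1 y]
      ket_pair_commute[of c d w])
  \<comment> \<open>Each of these factors needs either a pair from \<open>a\<close>,
    \<open>b\<close>, \<open>c\<close>, \<open>d\<close> or a pair containing an ancilla, and
    \<open>wxyz\<close> contains neither.\<close>
  have wxyz_idle: "?U1 *v ket [w, x, y, z] = ket [w, x, y, z]"
    "?U2 *v ket [w, x, y, z] = ket [w, x, y, z]"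
    "?U4 *v ket [w, x, y, z] = ket [w, x, y, z]"
    "?U5 *v ket [w, x, y, z] = ket [w, x, y, z]"
    using orbitals by (auto intro!: ucc_ket_idle)
  note lin = matrix_vector_right_distrib matrix_vector_mult_diff_distrib mv_smult
  have V_abcd: "V *v ket [a, b, c, d] = Q *v ket [a, b, c, d]"
    by (simp only: V Q_abcd transfer C_ancillas lin restore wxyz_idle)
  have V_wxyz: "V *v ket [w, x, y, z] = Q *v ket [w, x, y, z]"
    by (simp only: V Q_wxyz C_wxyz lin restore wxyz_idle)

  have P12: "V *v ket [a, b, f, g] = ket [a, b, f, g]"
    "Q *v ket [a, b, f, g] = ket [a, b, f, g]" if "(f, g) \<in> P12" for f g
  proof -
    from pairs[of f g] that
    have new: "f \<noteq> g" "{f, g} \<inter> {a, b, c, d, w, x, y, z, \<eta>1, \<eta>2} = {}" by auto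
    have "?U1 *v ket [a, b, f, g] = ket [w, \<eta>1, f, g]"
      using orbitals new by (intro U1) auto
    moreover have "?U2 *v ket [w, \<eta>1, f, g] = ket [w, \<eta>1, f, g]"
      using orbitals new by (intro ucc_ket_idle) auto
    \<comment> \<open>The control \<open>y\<close> is empty here.\<close>
    moreover have "?C *v ket [w, \<eta>1, f, g] = ket [w, \<eta>1, f, g]"
      using orbitals new by (auto simp: ctrl_ucc_ket)
    moreover have "?U4 *v ket [w, \<eta>1, f, g] = ket [w, \<eta>1, f, g]"
      using orbitals new by (intro ucc_ket_idle) auto
    moreover have "?U5 *v ket [w, \<eta>1, f, g] = ket [a, b, f, g]"
      using orbitals new by (intro U5) auto
    ultimately show "V *v ket [a, b, f, g] = ket [a, b, f, g]" by (simp only: V)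
    show "Q *v ket [a, b, f, g] = ket [a, b, f, g]"
      unfolding Q_def using orbitals new by (intro ucc_ket_idle) auto
  qed
  have P34: "V *v ket [c, d, f, g] = ket [c, d, f, g]"
    "Q *v ket [c, d, f, g] = ket [c, d, f, g]" if "(f, g) \<in> P34" for f g
  proof -
    from pairs[of f g] that
    have new: "f \<noteq> g" "{f, g} \<inter> {a, b, c, d, w, x, y, z, \<eta>1, \<eta>2} = {}" by auto
    have "?U1 *v ket [c, d, f, g] = ket [c, d, f, g]"
      using orbitals new by (intro ucc_ket_idle) auto
    moreover have "?U2 *v ket [c, d, f, g] = ket [y, \<eta>2, f, g]"
      using orbitals new by (intro U2) auto
    \<comment> \<open>The control \<open>w\<close> is empty here.\<close>
    moreover have "?C *v ket [y, \<eta>2, f, g] = ket [y, \<eta>2, f, g]"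
      using orbitals new by (auto simp: ctrl_ucc_ket)
    moreover have "?U4 *v ket [y, \<eta>2, f, g] = ket [c, d, f, g]"
      using orbitals new by (intro U4) auto
    moreover have "?U5 *v ket [c, d, f, g] = ket [c, d, f, g]"
      using orbitals new by (intro ucc_ket_idle) auto
    ultimately show "V *v ket [c, d, f, g] = ket [c, d, f, g]" by (simp only: V)
    show "Q *v ket [c, d, f, g] = ket [c, d, f, g]"
      unfolding Q_def using orbitals new by (intro ucc_ket_idle) auto
  qed

  \<comment> \<open>The right-hand side does not mention \<open>M\<close>, so its two instances give
    equality of \<open>V\<close> and \<open>Q\<close> on the whole superposition.\<close>
  have action: "M *v \<Psi> = \<xi>1 *s (Q *v ket [a, b, c, d])
        + (\<Sum>(\<phi>1, \<phi>2)\<in>P12. \<xi>2 \<phi>1 \<phi>2 *s ket [a, b, \<phi>1, \<phi>2])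
        + (\<Sum>(\<phi>3, \<phi>4)\<in>P34. \<xi>3 \<phi>3 \<phi>4 *s ket [c, d, \<phi>3, \<phi>4])
        + \<xi>4 *s (Q *v ket [w, x, y, z])" if M: "M = V \<or> M = Q" for M
  proof -
    have "(\<Sum>(f, g)\<in>P12. M *v (\<xi>2 f g *s ket [a, b, f, g])) = (\<Sum>(f, g)\<in>P12. \<xi>2 f g *s ket [a, b, f, g])"
      "(\<Sum>(f, g)\<in>P34. M *v (\<xi>3 f g *s ket [c, d, f, g])) = (\<Sum>(f, g)\<in>P34. \<xi>3 f g *s ket [c, d, f, g])"
      using M P12 P34 by (auto intro!: sum.cong simp: mv_smult)
    moreover have "M *v ket [a, b, c, d] = Q *v ket [a, b, c, d]"
      "M *v ket [w, x, y, z] = Q *v ket [w, x, y, z]"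
      using M V_abcd V_wxyz by auto
    ultimately show ?thesis
      by (simp add: Psi matrix_vector_right_distrib mv_sum mv_smult split_def)
  qed
  have "Q *v \<Psi> = (?co * \<xi>1) *s ket [a, b, c, d] + (?si * \<xi>1) *s ket [w, x, y, z]
        + (\<Sum>(\<phi>1, \<phi>2)\<in>P12. \<xi>2 \<phi>1 \<phi>2 *s ket [a, b, \<phi>1, \<phi>2])
        + (\<Sum>(\<phi>3, \<phi>4)\<in>P34. \<xi>3 \<phi>3 \<phi>4 *s ket [c, d, \<phi>3, \<phi>4])
        + (?co * \<xi>4) *s ket [w, x, y, z] - (?si * \<xi>4) *s ket [a, b, c, d]"
    unfolding action[OF disjI2, OF refl] Q_abcd Q_wxyz
    by (simp add: vec_eq_iff algebra_simps)
  moreover have "V *v \<Psi> = Q *v \<Psi>" using action by simp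
  ultimately show ?thesis by (simp only: V Q simp_thms)
qed

end
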